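(* Let $(S,\bullet)$ be a groupoid. Then $(S,\bullet)$ is a completely inverse AG**-groupoid if and only if there exist a binary operation $\circ$ on $S$ such that $(S,\circ)$ is a semilattice of abelian groups, and an involutive, idempotent-fixed automorphism $A$ of $(S,\circ)$, such that $a\bullet b=(Aa)\circ b$ for all $a,b\in S$.
   Context: A groupoid is a set with a binary operation. An AG-groupoid is a groupoid satisfying $(xy)z=(zy)x$; an AG**-groupoid is an AG-groupoid that also satisfies $x(yz)=y(xz)$. In a groupoid, $b$ is an inverse of $a$ if $(ab)a=a$ and $(ba)b=b$. A groupoid is completely inverse if every element $a$ has a unique inverse $a^{-1}$ and $aa^{-1}=a^{-1}a$. A completely inverse AG**-groupoid is an AG**-groupoid that is completely inverse. A semilattice of abelian groups is a semigroup that is a disjoint union of subsemigroups $G_\alpha$ ($\alpha\in Y$), each of which is an abelian group, indexed by a semilattice $Y$ (commutative semigroup of idempotents), with $G_\alpha G_\beta\subseteq G_{\alpha\beta}$; equivalently, a commutative inverse semigroup. An automorphism $A$ of a groupoid $(S,\circ)$ is involutive if $A^2$ is the identity map on $S$, and idempotent-fixed if $Ae=e$ for every $e\in S$ with $e\circ e=e$. *)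

theory Defs
  imports "HOL-Library.Disjoint_Sets" "HOL-Algebra.Group"
begin

text \<open>
  Structures are given by a carrier set and a binary operation; all laws are relativised to the
  carrier. The carrier may be empty.
\<close>

locale groupoid_on =
  fixes S :: "'a set" and f :: "'a \<Rightarrow> 'a \<Rightarrow> 'a"
  assumes closed: "\<lbrakk>x \<in> S; y \<in> S\<rbrakk> \<Longrightarrow> f x y \<in> S"

locale semigroup_on = groupoid_on +
  assumes assoc: "\<lbrakk>x \<in> S; y \<in> S; z \<in> S\<rbrakk> \<Longrightarrow> f (f x y) z = f x (f y z)"

locale semilattice_on = semigroup_on +
  assumes commute: "\<lbrakk>x \<in> S; y \<in> S\<rbrakk> \<Longrightarrow> f x y = f y x"
    and idem: "x \<in> S \<Longrightarrow> f x x = x"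

locale ag_groupoid_on = groupoid_on +
  assumes left_invertive: "\<lbrakk>x \<in> S; y \<in> S; z \<in> S\<rbrakk> \<Longrightarrow> f (f x y) z = f (f z y) x"

locale ag_star_star_groupoid_on = ag_groupoid_on +
  assumes left_permutable: "\<lbrakk>x \<in> S; y \<in> S; z \<in> S\<rbrakk> \<Longrightarrow> f x (f y z) = f y (f x z)"

definition inverse_of :: "('a \<Rightarrow> 'a \<Rightarrow> 'a) \<Rightarrow> 'a \<Rightarrow> 'a \<Rightarrow> bool" where
  "inverse_of f a b \<longleftrightarrow> f (f a b) a = a \<and> f (f b a) b = b"

locale completely_inverse_on = groupoid_on +
  assumes unique_inverse: "a \<in> S \<Longrightarrow> \<exists>!b. b \<in> S \<and> inverse_of f a b"
    and inverse_commute: "\<lbrakk>a \<in> S; b \<in> S; inverse_of f a b\<rbrakk> \<Longrightarrow> f a b = f b a"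

locale completely_inverse_ag_star_star_groupoid_on =
  ag_star_star_groupoid_on + completely_inverse_on

definition abelian_group_on :: "'a set \<Rightarrow> ('a \<Rightarrow> 'a \<Rightarrow> 'a) \<Rightarrow> bool" where
  "abelian_group_on G f \<longleftrightarrow> (\<exists>e. comm_group \<lparr>carrier = G, monoid.mult = f, one = e\<rparr>)"

locale semilattice_decomposition = semigroup_on S f + Y: semilattice_on Y m
  for S :: "'a set" and f :: "'a \<Rightarrow> 'a \<Rightarrow> 'a"
    and Y :: "'i set" and m :: "'i \<Rightarrow> 'i \<Rightarrow> 'i" and G :: "'i \<Rightarrow> 'a set" +
  assumes abelian_groups: "i \<in> Y \<Longrightarrow> abelian_group_on (G i) f"
    and disjoint: "disjoint_family_on G Y"
    and union: "S = (\<Union>i\<in>Y. G i)"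
    and mult_mem: "\<lbrakk>i \<in> Y; j \<in> Y; x \<in> G i; y \<in> G j\<rbrakk> \<Longrightarrow> f x y \<in> G (m i j)"

text \<open>
  HOL cannot quantify over the type of indices, so they are taken from the element type. This is
  no restriction: the components are nonempty and disjoint, hence can be indexed by one of their
  own elements (see the lemma below).
\<close>

definition semilattice_of_abelian_groups :: "'a set \<Rightarrow> ('a \<Rightarrow> 'a \<Rightarrow> 'a) \<Rightarrow> bool" where
  "semilattice_of_abelian_groups S f \<longleftrightarrow>
     (\<exists>(Y :: 'a set) m G. semilattice_decomposition S f Y m G)"

lemma semilattice_of_abelian_groupsI:
  fixes Y :: "'i set"
  assumes "semilattice_decomposition S f Y m G"
  shows "semilattice_of_abelian_groups S f"
proof -
  interpret semilattice_decomposition S f Y m G by fact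
  have "\<exists>e. e \<in> G i" if i: "i \<in> Y" for i
  proof -
    obtain e where "comm_group \<lparr>carrier = G i, monoid.mult = f, one = e\<rparr>"
      using abelian_groups[OF i] by (auto simp: abelian_group_on_def)
    then interpret C: comm_group "\<lparr>carrier = G i, monoid.mult = f, one = e\<rparr>" .
    show ?thesis using C.one_closed by auto
  qed
  then obtain r where r: "\<And>i. i \<in> Y \<Longrightarrow> r i \<in> G i" by metis
  have inj: "inj_on r Y"
    using r disjoint unfolding inj_on_def disjoint_family_on_def by (metis IntI empty_iff)
  define q where "q = the_inv_into Y r"
  have q: "q (r i) = i" if "i \<in> Y" for i
    using the_inv_into_f_f[OF inj that] by (simp add: q_def)
  have "semilattice_decomposition S f (r ` Y) (\<lambda>x y. r (m (q x) (q y))) (\<lambda>x. G (q x))"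
  proof unfold_locales
    show "disjoint_family_on (\<lambda>x. G (q x)) (r ` Y)"
      using disjoint q unfolding disjoint_family_on_def by (metis imageE)
    show "S = (\<Union>x\<in>r ` Y. G (q x))" using union q by auto
  qed (auto simp: q Y.closed Y.assoc Y.idem abelian_groups mult_mem intro: arg_cong[OF Y.commute])
  then show ?thesis unfolding semilattice_of_abelian_groups_def by blast
qed

definition automorphism_on :: "'a set \<Rightarrow> ('a \<Rightarrow> 'a \<Rightarrow> 'a) \<Rightarrow> ('a \<Rightarrow> 'a) \<Rightarrow> bool" where
  "automorphism_on S f A \<longleftrightarrow> bij_betw A S S \<and> (\<forall>x\<in>S. \<forall>y\<in>S. A (f x y) = f (A x) (A y))"

definition involutive_on :: "'a set \<Rightarrow> ('a \<Rightarrow> 'a) \<Rightarrow> bool" where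
  "involutive_on S A \<longleftrightarrow> (\<forall>x\<in>S. A (A x) = x)"

definition idempotent_fixed_on :: "'a set \<Rightarrow> ('a \<Rightarrow> 'a \<Rightarrow> 'a) \<Rightarrow> ('a \<Rightarrow> 'a) \<Rightarrow> bool" where
  "idempotent_fixed_on S f A \<longleftrightarrow> (\<forall>e\<in>S. f e e = e \<longrightarrow> A e = e)"

end

theory Submission imports Defs begin

text \<open>
  Write \<open>\<circ>\<close> for the associative operation and \<open>\<bullet>\<close> for the other one. Everything rests on the fact
  that semilattices of abelian groups are exactly the commutative semigroups in which every
  element is regular, i.e. \<open>a = a b a\<close> for some \<open>b\<close>: the component of an idempotent \<open>e\<close> is the group
  of units of the monoid \<open>e S\<close>. Both directions of the theorem can then be calculated in terms of
  identities for the two operations.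

  If \<open>a \<bullet> b = A a \<circ> b\<close>, then \<open>(x \<bullet> y) \<bullet> z = x \<circ> A y \<circ> z\<close> and \<open>x \<bullet> (y \<bullet> z) = A x \<circ> A y \<circ> z\<close>, because \<open>A\<close>
  is an involutive automorphism; the two laws of AG**-groupoids express the symmetry of these
  products. The first formula also shows that \<open>b\<close> is a \<open>\<bullet>\<close>-inverse of \<open>a\<close> iff \<open>A b\<close> is
  a \<open>\<circ>\<close>-inverse of \<open>a\<close>. Hence \<open>\<bullet>\<close>-inverses exist and are unique, and since \<open>A\<close> fixes the
  idempotent \<open>a \<circ> A b\<close>, we get \<open>a \<bullet> b = A (a \<circ> A b) = a \<circ> A b = b \<bullet> a\<close>.

  Conversely, the equation \<open>a \<bullet> b = A a \<circ> b\<close> leaves no choice for \<open>A\<close>: evaluating it at the identity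
  \<open>e = a \<bullet> a\<inverse>\<close> of the component of \<open>a\<close> gives \<open>A a = a \<bullet> e\<close>, and then
  \<open>a \<circ> b = A a \<bullet> b\<close>. The medial law \<open>(a b) (c d) = (a c) (b d)\<close> makes \<open>A\<close> a homomorphism,
  and together with the law \<open>(a b) (c d) = (d b) (c a)\<close> it makes \<open>\<circ>\<close> commutative;
  the left invertive law then turns into associativity of \<open>\<circ>\<close>.
\<close>

section \<open>Semilattices of abelian groups as commutative regular semigroups\<close>

text \<open>
  Let \<open>x\<close> and \<open>y\<close> lie in the components of \<open>i\<close> and \<open>j\<close>. The identity \<open>g\<close> of the component of
  \<open>i j\<close> satisfies \<open>g x = x g\<close>, since both sides lie in that component, and \<open>g y = y g\<close> likewise.
  So \<open>x y = (g x) (y g)\<close> and \<open>y x = (g y) (x g)\<close> are products of the same two elements of an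
  abelian group.
\<close>
lemma (in semilattice_decomposition) commutative:
  assumes "x \<in> S" "y \<in> S"
  shows "f x y = f y x"
proof -
  obtain i j where ij: "i \<in> Y" "j \<in> Y" "x \<in> G i" "y \<in> G j"
    using assms union by auto
  let ?k = "m i j"
  have k: "?k \<in> Y" using ij by (simp add: Y.closed)
  have ki: "m ?k i = ?k" "m i ?k = ?k" and kj: "m ?k j = ?k" "m j ?k = ?k"
    using ij k by (metis Y.assoc Y.commute Y.idem)+
  obtain g where "comm_group \<lparr>carrier = G ?k, monoid.mult = f, one = g\<rparr>"
    using abelian_groups[OF k] by (auto simp: abelian_group_on_def)
  then interpret K: comm_group "\<lparr>carrier = G ?k, monoid.mult = f, one = g\<rparr>" .
  have g: "g \<in> G ?k" using K.one_closed by simp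
  have unit: "f g z = z" "f z g = z" if "z \<in> G ?k" for z
    using that K.l_one K.r_one by auto
  have comm: "f u v = f v u" if "u \<in> G ?k" "v \<in> G ?k" for u v
    using that K.m_comm by auto
  have sub: "z \<in> S" if "z \<in> G ?k" for z using that k union by auto
  have mem: "f g x \<in> G ?k" "f x g \<in> G ?k" "f g y \<in> G ?k" "f y g \<in> G ?k"
    using mult_mem[OF k ij(1) g ij(3)] mult_mem[OF ij(1) k ij(3) g]
      mult_mem[OF k ij(2) g ij(4)] mult_mem[OF ij(2) k ij(4) g] ki kj by auto
  have xy: "f x y \<in> G ?k" "f y x \<in> G ?k"
    using mult_mem[OF ij] mult_mem[OF ij(2,1,4,3)] Y.commute[OF ij(1,2)] by auto
  have gS: "g \<in> S" using g sub by blast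
  have gx: "f g x = f x g"
    using unit(2)[OF mem(1)] unit(1)[OF mem(2)] assoc[OF gS assms(1) gS] by simp
  have gy: "f g y = f y g"
    using unit(2)[OF mem(3)] unit(1)[OF mem(4)] assoc[OF gS assms(2) gS] by simp
  have split: "f u v = f (f g u) (f v g)" if "u \<in> S" "v \<in> S" "f u v \<in> G ?k" for u v
  proof -
    have "f u v = f (f g (f u v)) g" using unit that(3) by simp
    also have "\<dots> = f (f g u) (f v g)" using that gS by (simp add: assoc closed)
    finally show ?thesis .
  qed
  have "f x y = f (f g x) (f y g)" using split assms xy by blast
  also have "\<dots> = f (f y g) (f g x)" using comm mem by blast
  also have "\<dots> = f (f g y) (f x g)" using gx gy by simp
  also have "\<dots> = f y x" using split assms xy by metis
  finally show ?thesis .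
qed

lemma (in semilattice_decomposition) regular:
  assumes "a \<in> S"
  shows "\<exists>b\<in>S. f (f a b) a = a"
proof -
  obtain i where i: "i \<in> Y" "a \<in> G i" using assms union by auto
  obtain e where "comm_group \<lparr>carrier = G i, monoid.mult = f, one = e\<rparr>"
    using abelian_groups[OF i(1)] by (auto simp: abelian_group_on_def)
  then interpret C: comm_group "\<lparr>carrier = G i, monoid.mult = f, one = e\<rparr>" .
  obtain b where "b \<in> G i" "f a b = e"
    using C.r_inv_ex i(2) by auto
  then show ?thesis using C.l_one i union by auto
qed

locale commutative_regular_semigroup_on = semigroup_on +
  assumes commute: "\<lbrakk>x \<in> S; y \<in> S\<rbrakk> \<Longrightarrow> f x y = f y x"
    and regular: "a \<in> S \<Longrightarrow> \<exists>b\<in>S. f (f a b) a = a"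
begin

lemma interchange:
  "\<lbrakk>x \<in> S; y \<in> S; z \<in> S; w \<in> S\<rbrakk> \<Longrightarrow> f (f x y) (f z w) = f (f x z) (f y w)"
  by (metis assoc closed commute)

text \<open>
  If \<open>a = a b a\<close>, then \<open>b a b\<close> is an inverse of \<open>a\<close>. An inverse \<open>b\<close> is determined by the
  idempotent \<open>a b\<close>, as \<open>b = b (a b)\<close>; and for inverses \<open>b\<close> and \<open>c\<close> the idempotents
  \<open>a b\<close> and \<open>a c\<close> absorb each other.
\<close>
lemma ex1_inverse:
  assumes a: "a \<in> S"
  shows "\<exists>!b. b \<in> S \<and> inverse_of f a b"
proof -
  obtain b where b: "b \<in> S" "f (f a b) a = a" using regular a by blast
  let ?b = "f (f b a) b"
  have "f (f a ?b) a = f (f (f (f a b) a) b) a" "f (f ?b a) ?b = f (f b (f (f (f (f a b) a) b) a)) b"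
    using a b(1) by (simp_all add: assoc closed)
  then have ex: "?b \<in> S \<and> inverse_of f a ?b"
    using a b by (simp add: inverse_of_def closed)
  have unique: "b = c"
    if "b \<in> S" "c \<in> S" "inverse_of f a b" "inverse_of f a c" for b c
  proof -
    have "f a b = f (f a c) (f a b)"
      using that a by (metis assoc closed inverse_of_def)
    also have "\<dots> = f (f a b) (f a c)" using that a by (simp add: commute closed)
    also have "\<dots> = f a c" using that a by (metis assoc closed inverse_of_def)
    finally have "f a b = f a c" .
    then show ?thesis using that a by (metis assoc commute inverse_of_def)
  qed
  show ?thesis using ex unique by blast
qed

text \<open>The group of units of the monoid \<open>e S\<close>, whose identity is the idempotent \<open>e\<close>.\<close>
definition unit_group :: "'a \<Rightarrow> 'a set" where
  "unit_group e = {a \<in> S. f a e = a \<and> (\<exists>b\<in>S. f b e = b \<and> f a b = e)}"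

lemma unit_group_mult:
  assumes e: "e \<in> S" "d \<in> S" and "x \<in> unit_group e" "y \<in> unit_group d"
  shows "f x y \<in> unit_group (f e d)"
proof -
  obtain b where b: "x \<in> S" "f x e = x" "b \<in> S" "f b e = b" "f x b = e"
    using assms by (auto simp: unit_group_def)
  obtain c where c: "y \<in> S" "f y d = y" "c \<in> S" "f c d = c" "f y c = d"
    using assms by (auto simp: unit_group_def)
  have "f (f x y) (f e d) = f x y" "f (f b c) (f e d) = f b c" "f (f x y) (f b c) = f e d"
    using b c e interchange[of x y e d] interchange[of b c e d] interchange[of x y b c] by simp_all
  then show ?thesis using b c by (auto simp: unit_group_def closed)
qed

lemma abelian_group_on_unit_group:
  assumes e: "e \<in> S" "f e e = e"
  shows "abelian_group_on (unit_group e) f"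
  unfolding abelian_group_on_def
proof (intro exI comm_groupI, simp_all)
  show "e \<in> unit_group e" using e by (auto simp: unit_group_def)
next
  fix x assume x: "x \<in> unit_group e"
  then obtain y where y: "x \<in> S" "f x e = x" "y \<in> S" "f y e = y" "f x y = e"
    by (auto simp: unit_group_def)
  then show "f e x = x" using commute[of e x] e by simp
  have "f y x = e" using y commute by metis
  moreover from this have "y \<in> unit_group e" using y by (auto simp: unit_group_def)
  ultimately show "\<exists>y\<in>unit_group e. f y x = e" by blast
next
  fix x y assume "x \<in> unit_group e" "y \<in> unit_group e"
  then show "f x y \<in> unit_group e" using unit_group_mult[OF e(1) e(1)] e by simp
qed (auto simp: unit_group_def assoc commute)

text \<open>
  If \<open>a b = e\<close> and \<open>a\<close> also lies in the group of \<open>d\<close>, then \<open>e d = b (a d) = b a = e\<close>; so the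
  groups of distinct idempotents are disjoint.
\<close>
lemma unit_group_disjoint:
  assumes "e \<in> S" "d \<in> S" "a \<in> unit_group e" "a \<in> unit_group d"
  shows "e = d"
proof -
  have absorb: "f e d = e" if mem: "e \<in> S" "d \<in> S" "a \<in> unit_group e" "a \<in> unit_group d" for e d
  proof -
    obtain b where b: "a \<in> S" "b \<in> S" "f a b = e" "f a d = a"
      using mem by (auto simp: unit_group_def)
    then have "f e d = f (f b a) d" using commute[of a b] by simp
    also have "\<dots> = e" using b mem(2) assoc[of b a d] commute[of a b] by simp
    finally show ?thesis .
  qed
  then show ?thesis using assms by (metis commute)
qed

text \<open>
  The semilattice is that of the idempotents, and if \<open>a = a b a\<close>, then \<open>a\<close> lies in the group of
  \<open>a b\<close> and has \<open>b a b\<close> as its inverse there.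
\<close>
lemma semilattice_of_abelian_groups: "semilattice_of_abelian_groups S f"
proof -
  let ?Y = "{e \<in> S. f e e = e}"
  have "a \<in> (\<Union>e\<in>?Y. unit_group e)" if a: "a \<in> S" for a
  proof -
    obtain b where b: "b \<in> S" "f (f a b) a = a" using regular a by blast
    let ?e = "f a b" and ?b = "f b (f a b)"
    have e: "?e \<in> S" "f ?e ?e = ?e" using a b by (metis closed, metis assoc closed)
    have "f a ?e = a" using a b e by (metis commute)
    moreover have "f ?b ?e = ?b" using a b e by (metis assoc)
    moreover have "f a ?b = ?e" using a b e by (metis assoc)
    ultimately have "a \<in> unit_group ?e" using a b e by (auto simp: unit_group_def closed)
    then show ?thesis using e by blast
  qed
  then have union: "S = (\<Union>e\<in>?Y. unit_group e)" by (auto simp: unit_group_def)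
  have "semilattice_decomposition S f ?Y f unit_group"
  proof unfold_locales
    show "disjoint_family_on unit_group ?Y"
      using unit_group_disjoint by (fastforce simp: disjoint_family_on_def)
    show "S = (\<Union>e\<in>?Y. unit_group e)" by (rule union)
  next
    fix x y assume "x \<in> ?Y" "y \<in> ?Y"
    then show "f x y \<in> ?Y" by (simp add: interchange closed)
  qed (auto simp: assoc commute abelian_group_on_unit_group unit_group_mult)
  then show ?thesis by (rule semilattice_of_abelian_groupsI)
qed

end

lemma semilattice_of_abelian_groups_iff:
  "semilattice_of_abelian_groups S f \<longleftrightarrow> commutative_regular_semigroup_on S f"
proof
  assume "semilattice_of_abelian_groups S f"
  then obtain Y m G where "semilattice_decomposition S f (Y :: 'a set) m G"
    by (auto simp: semilattice_of_abelian_groups_def)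
  then interpret semilattice_decomposition S f Y m G .
  show "commutative_regular_semigroup_on S f"
    by unfold_locales (auto intro: commutative regular)
qed (rule commutative_regular_semigroup_on.semilattice_of_abelian_groups)

section \<open>Twisting a commutative regular semigroup by an automorphism\<close>

text \<open>
  The formulas \<open>left\<close> and \<open>right\<close> reduce both laws to commutativity. Applying \<open>A\<close> to
  the second condition for an inverse turns \<open>\<bullet>\<close>-inverses \<open>b\<close> of \<open>a\<close> into \<open>\<circ>\<close>-inverses \<open>A b\<close>. It
  is the commutation \<open>a \<bullet> b = b \<bullet> a\<close> of inverses that requires idempotents to be fixed.
\<close>
lemma (in commutative_regular_semigroup_on) completely_inverse_twist:
  assumes aut: "automorphism_on S f A" and inv: "involutive_on S A"
    and fixed: "idempotent_fixed_on S f A"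
    and g: "\<And>a b. \<lbrakk>a \<in> S; b \<in> S\<rbrakk> \<Longrightarrow> g a b = f (A a) b"
  shows "completely_inverse_ag_star_star_groupoid_on S g"
proof -
  have A: "A x \<in> S" "A (A x) = x" if "x \<in> S" for x
    using that aut inv by (auto simp: automorphism_on_def involutive_on_def bij_betw_def)
  have hom: "A (f x y) = f (A x) (A y)" if "x \<in> S" "y \<in> S" for x y
    using that aut by (auto simp: automorphism_on_def)
  have g_closed: "g x y \<in> S" if "x \<in> S" "y \<in> S" for x y
    using that by (simp add: g A closed)
  have left: "g (g x y) z = f (f x (A y)) z" if "x \<in> S" "y \<in> S" "z \<in> S" for x y z
    using that by (simp add: g A closed hom)
  have right: "g x (g y z) = f (A x) (f (A y) z)" if "x \<in> S" "y \<in> S" "z \<in> S" for x y z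
    using that by (simp add: g A closed)
  have inverse: "inverse_of g a b \<longleftrightarrow> inverse_of f a (A b)" if ab: "a \<in> S" "b \<in> S" for a b
  proof -
    have "f (f b (A a)) b = b \<longleftrightarrow> f (f (A b) a) (A b) = A b"
    proof -
      have "A (f (f b (A a)) b) = f (f (A b) a) (A b)" using ab by (simp add: hom A closed)
      moreover have "A x = A y \<longleftrightarrow> x = y" if "x \<in> S" "y \<in> S" for x y using that by (metis A(2))
      ultimately show ?thesis using ab by (metis A(1) closed)
    qed
    then show ?thesis using ab by (simp add: inverse_of_def left)
  qed
  show ?thesis
  proof unfold_locales
    fix x y z assume xyz: "x \<in> S" "y \<in> S" "z \<in> S"
    have "f (f x (A y)) z = f x (f z (A y))"
      using xyz assoc[of x "A y" z] commute[of "A y" z] by (simp add: A(1))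
    also have "\<dots> = f (f z (A y)) x"
      using xyz commute[of x "f z (A y)"] by (simp add: A(1) closed)
    finally show "g (g x y) z = g (g z y) x" using xyz by (simp add: left)
    have "f (A x) (f (A y) z) = f (A y) (f (A x) z)"
      using xyz assoc[of "A x" "A y" z] assoc[of "A y" "A x" z] commute[of "A x" "A y"]
      by (simp add: A(1))
    then show "g x (g y z) = g y (g x z)" using xyz by (simp add: right)
  next
    fix a assume a: "a \<in> S"
    obtain c where c: "c \<in> S" "inverse_of f a c"
        and unique: "\<And>b. b \<in> S \<Longrightarrow> inverse_of f a b \<Longrightarrow> b = c"
      using ex1_inverse[OF a] by blast
    show "\<exists>!b. b \<in> S \<and> inverse_of g a b"
    proof (intro ex1I conjI)
      show "A c \<in> S" "inverse_of g a (A c)" using a c by (simp_all add: A inverse)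
      show "b = A c" if "b \<in> S \<and> inverse_of g a b" for b
        using that unique[of "A b"] a by (metis A inverse)
    qed
  next
    fix a b assume ab: "a \<in> S" "b \<in> S" "inverse_of g a b"
    let ?e = "f a (A b)"
    have "f (f ?e a) (A b) = ?e"
      using ab inverse[of a b] by (simp add: inverse_of_def[of f])
    then have "f ?e ?e = ?e"
      using ab assoc[of ?e a "A b"] by (simp add: A(1) closed)
    then have "A ?e = ?e"
      using ab fixed by (simp add: idempotent_fixed_on_def A closed)
    moreover have "g a b = A ?e" using ab by (simp add: g hom A)
    moreover have "g b a = ?e" using ab commute[of a "A b"] by (simp add: g A)
    ultimately show "g a b = g b a" by simp
  qed (rule g_closed)
qed

section \<open>The semigroup underlying a completely inverse AG**-groupoid\<close>

context ag_star_star_groupoid_on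
begin

lemma medial:
  "\<lbrakk>a \<in> S; b \<in> S; c \<in> S; d \<in> S\<rbrakk> \<Longrightarrow> f (f a b) (f c d) = f (f a c) (f b d)"
  by (metis closed left_invertive)

lemma paramedial:
  "\<lbrakk>a \<in> S; b \<in> S; c \<in> S; d \<in> S\<rbrakk> \<Longrightarrow> f (f a b) (f c d) = f (f d b) (f c a)"
  by (metis closed left_invertive left_permutable)

end

context completely_inverse_ag_star_star_groupoid_on
begin

definition the_inverse :: "'a \<Rightarrow> 'a" where
  "the_inverse a = (THE b. b \<in> S \<and> inverse_of f a b)"

text \<open>
  The identity of the component of \<open>a\<close> in the semilattice of groups to be constructed; it is
  written \<open>e\<^sub>a\<close> in the comments below.
\<close>
definition unit :: "'a \<Rightarrow> 'a" where
  "unit a = f a (the_inverse a)"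

text \<open>The automorphism written \<open>A\<close> in the comments.\<close>
definition twist :: "'a \<Rightarrow> 'a" where
  "twist a = f a (unit a)"

definition circ :: "'a \<Rightarrow> 'a \<Rightarrow> 'a" where
  "circ a b = f (twist a) b"

lemma the_inverse:
  assumes "a \<in> S"
  shows the_inverse_closed: "the_inverse a \<in> S"
    and inverse_of_the_inverse: "inverse_of f a (the_inverse a)"
  using theI'[OF unique_inverse[OF assms]] by (auto simp: the_inverse_def)

lemma the_inverse_eqI:
  assumes "a \<in> S" "b \<in> S" "inverse_of f a b"
  shows "the_inverse a = b"
  using assms the_inverse unique_inverse by blast

lemma unit_closed: "a \<in> S \<Longrightarrow> unit a \<in> S"
  by (simp add: unit_def closed the_inverse_closed)

lemma the_inverse_mult_self: "a \<in> S \<Longrightarrow> f (the_inverse a) a = unit a"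
  using inverse_commute[OF _ the_inverse] by (simp add: unit_def)

lemma unit_mult_self: "a \<in> S \<Longrightarrow> f (unit a) a = a"
  using inverse_of_the_inverse by (simp add: unit_def inverse_of_def)

lemma unit_mult_the_inverse: "a \<in> S \<Longrightarrow> f (unit a) (the_inverse a) = the_inverse a"
  using inverse_of_the_inverse the_inverse_mult_self by (simp add: inverse_of_def)

text \<open>Indeed \<open>(a a\<inverse>) (a\<inverse> a) = a\<inverse> ((a a\<inverse>) a) = a\<inverse> a\<close>.\<close>
lemma unit_idem: "a \<in> S \<Longrightarrow> f (unit a) (unit a) = unit a"
  by (metis the_inverse_closed the_inverse_mult_self left_permutable unit_closed unit_def unit_mult_self)

lemma unit_eqI:
  assumes "a \<in> S" "b \<in> S" "f a b = e" "f b a = e" "f e a = a" "f e b = b"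
  shows "unit a = e"
proof -
  have "the_inverse a = b" using assms by (intro the_inverse_eqI) (simp_all add: inverse_of_def)
  then show ?thesis using assms by (simp add: unit_def)
qed

text \<open>By the medial law, \<open>a\<inverse> b\<inverse>\<close> is the inverse of \<open>a b\<close>.\<close>
lemma unit_mult:
  assumes "a \<in> S" "b \<in> S"
  shows "unit (f a b) = f (unit a) (unit b)"
proof (rule unit_eqI)
  show "f (f a b) (f (the_inverse a) (the_inverse b)) = f (unit a) (unit b)"
    using assms by (simp add: medial the_inverse_closed unit_def)
  show "f (f (the_inverse a) (the_inverse b)) (f a b) = f (unit a) (unit b)"
    using assms by (simp add: medial the_inverse_closed the_inverse_mult_self)
  show "f (f (unit a) (unit b)) (f a b) = f a b"
    using assms by (simp add: medial unit_closed unit_mult_self)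
  show "f (f (unit a) (unit b)) (f (the_inverse a) (the_inverse b)) =
      f (the_inverse a) (the_inverse b)"
    using assms by (simp add: medial unit_closed the_inverse_closed unit_mult_the_inverse)
qed (use assms in \<open>simp_all add: closed the_inverse_closed\<close>)

lemma twist_closed: "a \<in> S \<Longrightarrow> twist a \<in> S"
  by (simp add: twist_def closed unit_closed)

lemma twist_mult: "\<lbrakk>a \<in> S; b \<in> S\<rbrakk> \<Longrightarrow> twist (f a b) = f (twist a) (twist b)"
  by (simp add: twist_def unit_mult medial unit_closed)

lemma unit_unit: "a \<in> S \<Longrightarrow> unit (unit a) = unit a"
  by (rule unit_eqI[where b = "unit a"]) (simp_all add: unit_closed unit_idem)

lemma unit_twist: "a \<in> S \<Longrightarrow> unit (twist a) = unit a"
  by (simp add: twist_def unit_mult unit_closed unit_unit unit_idem)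

text \<open>As \<open>e\<^sub>a\<close> is also the identity for \<open>a e\<^sub>a\<close>, we have \<open>A (A a) = (a e\<^sub>a) e\<^sub>a = (e\<^sub>a e\<^sub>a) a = a\<close>.\<close>
lemma twist_twist: "a \<in> S \<Longrightarrow> twist (twist a) = a"
  by (metis left_invertive twist_def unit_closed unit_idem unit_mult_self unit_twist)

lemma circ_closed: "\<lbrakk>a \<in> S; b \<in> S\<rbrakk> \<Longrightarrow> circ a b \<in> S"
  by (simp add: circ_def closed twist_closed)

lemma twist_circ: "\<lbrakk>a \<in> S; b \<in> S\<rbrakk> \<Longrightarrow> twist (circ a b) = circ (twist a) (twist b)"
  by (simp add: circ_def twist_mult twist_closed)

lemma circ_twist: "\<lbrakk>a \<in> S; b \<in> S\<rbrakk> \<Longrightarrow> circ (twist a) b = f a b"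
  by (simp add: circ_def twist_twist)

text \<open>
  Inserting \<open>b = e\<^sub>b b\<close> makes \<open>(a e\<^sub>a) b\<close> a product of two products, to which both four-variable
  laws apply; together they exchange \<open>a\<close> and \<open>b\<close>.
\<close>
lemma circ_commute:
  assumes "a \<in> S" "b \<in> S"
  shows "circ a b = circ b a"
proof -
  have "circ a b = f (f a (unit a)) (f (unit b) b)"
    using assms by (simp add: circ_def twist_def unit_mult_self)
  also have "\<dots> = f (f b (unit a)) (f (unit b) a)"
    using assms by (simp add: paramedial unit_closed)
  also have "\<dots> = f (f b (unit b)) (f (unit a) a)"
    using assms by (simp add: medial unit_closed)
  also have "\<dots> = circ b a"
    using assms by (simp add: circ_def twist_def unit_mult_self)
  finally show ?thesis .
qed

text \<open>
  Since \<open>(a \<circ> b) \<circ> c = (a \<bullet> A b) \<bullet> c\<close>, the left invertive law exchanges \<open>a\<close> and \<open>c\<close> in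
  \<open>(a \<circ> b) \<circ> c\<close>. For a commutative operation this is associativity.
\<close>
lemma circ_assoc:
  assumes "a \<in> S" "b \<in> S" "c \<in> S"
  shows "circ (circ a b) c = circ a (circ b c)"
proof -
  have expand: "circ (circ x y) z = f (f x (twist y)) z" if "x \<in> S" "y \<in> S" "z \<in> S" for x y z
    using that by (simp add: circ_def twist_mult twist_twist twist_closed)
  have "circ (circ a b) c = circ (circ c b) a"
    using assms by (simp add: expand left_invertive twist_closed)
  also have "\<dots> = circ a (circ b c)"
    using assms circ_closed circ_commute by metis
  finally show ?thesis .
qed

text \<open>The inverse of \<open>a\<close> with respect to \<open>\<circ>\<close> is \<open>A (a\<inverse>)\<close>, as \<open>a \<circ> A (a\<inverse>) = A (a \<bullet> a\<inverse>)\<close>.\<close>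
lemma commutative_regular_circ: "commutative_regular_semigroup_on S circ"
proof unfold_locales
  fix a assume a: "a \<in> S"
  have "circ a (twist (the_inverse a)) = twist (unit a)"
    using a by (simp add: circ_def unit_def the_inverse_closed flip: twist_mult)
  then have "circ (circ a (twist (the_inverse a))) a = a"
    using a by (simp add: circ_twist unit_closed unit_mult_self)
  then show "\<exists>b\<in>S. circ (circ a b) a = a"
    using a by (auto simp: the_inverse_closed twist_closed)
qed (auto simp: circ_closed circ_assoc intro: circ_commute)

lemma automorphism_twist: "automorphism_on S circ twist"
  unfolding automorphism_on_def
proof
  show "bij_betw twist S S"
    by (rule bij_betw_byWitness[where f' = twist]) (auto simp: twist_twist twist_closed)
qed (simp add: twist_circ)

text \<open>
  In \<open>x \<circ> x = x\<close>, which reads \<open>A x \<bullet> x = x\<close>, cancel one factor by multiplying with \<open>x\<inverse>\<close> from the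
  left, to obtain \<open>A x \<bullet> e = e\<close> for \<open>e = x\<inverse> \<bullet> x\<close>. Here \<open>A x \<bullet> e = A (A x) = x\<close>.
\<close>
lemma twist_idempotent:
  assumes x: "x \<in> S" and idem: "circ x x = x"
  shows "twist x = x"
proof -
  have "unit x = f (the_inverse x) (f (twist x) x)"
    using x idem by (simp add: circ_def the_inverse_mult_self)
  also have "\<dots> = f (twist x) (unit x)"
    using x left_permutable[OF the_inverse_closed twist_closed] by (simp add: the_inverse_mult_self)
  also have "\<dots> = twist (twist x)"
    using x by (simp add: unit_twist twist_def[of "twist x"])
  also have "\<dots> = x" using x by (rule twist_twist)
  finally have "unit x = x" .
  then show ?thesis using unit_mult_self[OF x] by (simp add: twist_def)
qed

end

section \<open>The characterization\<close>

theorem corollary22: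
  fixes S :: "'a set" and bullet :: "'a \<Rightarrow> 'a \<Rightarrow> 'a"
  assumes "groupoid_on S bullet"
  shows "completely_inverse_ag_star_star_groupoid_on S bullet \<longleftrightarrow>
    (\<exists>(circ :: 'a \<Rightarrow> 'a \<Rightarrow> 'a) (A :: 'a \<Rightarrow> 'a).
       semilattice_of_abelian_groups S circ \<and>
       automorphism_on S circ A \<and> involutive_on S A \<and> idempotent_fixed_on S circ A \<and>
       (\<forall>a\<in>S. \<forall>b\<in>S. bullet a b = circ (A a) b))"
proof
  assume "completely_inverse_ag_star_star_groupoid_on S bullet"
  then interpret completely_inverse_ag_star_star_groupoid_on S bullet .
  have "semilattice_of_abelian_groups S circ"
    by (simp add: semilattice_of_abelian_groups_iff commutative_regular_circ)
  moreover have "involutive_on S twist" by (simp add: involutive_on_def twist_twist)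
  moreover have "idempotent_fixed_on S circ twist"
    by (simp add: idempotent_fixed_on_def twist_idempotent)
  moreover have "\<forall>a\<in>S. \<forall>b\<in>S. bullet a b = circ (twist a) b" by (simp add: circ_twist)
  ultimately show "\<exists>(circ :: 'a \<Rightarrow> 'a \<Rightarrow> 'a) (A :: 'a \<Rightarrow> 'a).
       semilattice_of_abelian_groups S circ \<and>
       automorphism_on S circ A \<and> involutive_on S A \<and> idempotent_fixed_on S circ A \<and>
       (\<forall>a\<in>S. \<forall>b\<in>S. bullet a b = circ (A a) b)"
    using automorphism_twist by blast
qed (auto simp: semilattice_of_abelian_groups_iff
       intro: commutative_regular_semigroup_on.completely_inverse_twist)

end
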